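(* Let $\Gamma$ be a finite graph with vertex set $V$, and let $(G_v)_{v\in V}$, $(G^*_v)_{v\in V}$ be two families of groups indexed by $V$. Suppose that for every $v\in V$ the groups $G_v$ and $G^*_v$ are strongly commensurable with common subgroup $H_v$ (that is, $H_v$ is isomorphic to a subgroup of $G_v$ and to a subgroup of $G_v^*$, of the same finite index $[G_v:H_v]$ in both). Then the graph products $\mathbf G=\Pi_\Gamma (G_v)_{v\in V}$ and $\mathbf G^*=\Pi_\Gamma (G^*_v)_{v\in V}$ are strongly commensurable: there is a group isomorphic to a subgroup of index $\prod_{v\in V}[G_v:H_v]$ in $\mathbf G$ and to a subgroup of the same index $\prod_{v\in V}[G_v:H_v]$ in $\mathbf G^*$.
   Context: A graph $\Gamma$ on the vertex set $V$ is an antireflexive symmetric relation on $V$ (no loops, no multiple edges). For a family of groups $(G_v)_{v\in V}$, the graph product $\Pi_\Gamma (G_v)_{v\in V}$ is the direct limit (colimit in groups) of the groups $G_S=\prod_{v\in S}G_v$, where $S$ runs over the complete subgraphs of $\Gamma$ (subsets of $V$ whose elements are pairwise adjacent; the empty set and singletons are included), ordered by inclusion, with the obvious inclusions as maps. Equivalently, it is the quotient of the free product of the $G_v$ by the relations that elements of $G_v$ commute with elements of $G_w$ whenever $v,w$ are adjacent. Two groups $G,G^*$ are commensurable if there is a group $H$ isomorphic to a subgroup of finite index in both $G$ and $G^*$; they are strongly commensurable if $H$ can be chosen to have the same index in both $G$ and $G^*$. *)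

theory Defs
  imports "HOL-Algebra.Algebra"
begin

section \<open>Colimits of groups\<close>

text \<open>
  A diagram of groups is given by an index set \<open>I\<close>, a preorder \<open>leq\<close> on \<open>I\<close>, groups \<open>D i\<close>, and
  homomorphisms \<open>f i j : D i \<rightarrow> D j\<close> for \<open>leq i j\<close>. Its colimit is realised by words in the letters
  \<open>(i, x)\<close>, with \<open>x\<close> in \<open>D i\<close>, modulo the least congruence making each \<open>x \<mapsto> [(i, x)]\<close>
  a homomorphism and identifying \<open>(i, x)\<close> with \<open>(j, f i j x)\<close>.
  The facts \<open>group_colim_group\<close> and \<open>colim_group_universal\<close> below confirm that this is the colimit
  in the category of groups.
\<close>

definition colim_words :: "'i set \<Rightarrow> ('i \<Rightarrow> 'x monoid) \<Rightarrow> ('i \<times> 'x) list set"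
  where "colim_words I D = lists (SIGMA i:I. carrier (D i))"

inductive colim_eq ::
  "'i set \<Rightarrow> ('i \<Rightarrow> 'i \<Rightarrow> bool) \<Rightarrow> ('i \<Rightarrow> 'x monoid) \<Rightarrow> ('i \<Rightarrow> 'i \<Rightarrow> 'x \<Rightarrow> 'x)
    \<Rightarrow> ('i \<times> 'x) list \<Rightarrow> ('i \<times> 'x) list \<Rightarrow> bool"
  for I leq D f
  where
    refl: "w \<in> colim_words I D \<Longrightarrow> colim_eq I leq D f w w"
  | sym: "colim_eq I leq D f u w \<Longrightarrow> colim_eq I leq D f w u"
  | trans: "colim_eq I leq D f u v \<Longrightarrow> colim_eq I leq D f v w \<Longrightarrow> colim_eq I leq D f u w"
  | append: "colim_eq I leq D f u u' \<Longrightarrow> colim_eq I leq D f w w' \<Longrightarrow> colim_eq I leq D f (u @ w) (u' @ w')"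
  | one: "i \<in> I \<Longrightarrow> colim_eq I leq D f [(i, \<one>\<^bsub>D i\<^esub>)] []"
  | mult: "i \<in> I \<Longrightarrow> x \<in> carrier (D i) \<Longrightarrow> y \<in> carrier (D i)
      \<Longrightarrow> colim_eq I leq D f [(i, x), (i, y)] [(i, x \<otimes>\<^bsub>D i\<^esub> y)]"
  | map: "i \<in> I \<Longrightarrow> j \<in> I \<Longrightarrow> leq i j \<Longrightarrow> x \<in> carrier (D i)
      \<Longrightarrow> colim_eq I leq D f [(i, x)] [(j, f i j x)]"

definition colim_class ::
  "'i set \<Rightarrow> ('i \<Rightarrow> 'i \<Rightarrow> bool) \<Rightarrow> ('i \<Rightarrow> 'x monoid) \<Rightarrow> ('i \<Rightarrow> 'i \<Rightarrow> 'x \<Rightarrow> 'x)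
    \<Rightarrow> ('i \<times> 'x) list \<Rightarrow> ('i \<times> 'x) list set"
  where "colim_class I leq D f w = {w'. colim_eq I leq D f w w'}"

definition colim_group ::
  "'i set \<Rightarrow> ('i \<Rightarrow> 'i \<Rightarrow> bool) \<Rightarrow> ('i \<Rightarrow> 'x monoid) \<Rightarrow> ('i \<Rightarrow> 'i \<Rightarrow> 'x \<Rightarrow> 'x)
    \<Rightarrow> ('i \<times> 'x) list set monoid"
  where "colim_group I leq D f =
    \<lparr>carrier = colim_class I leq D f ` colim_words I D,
     monoid.mult = (\<lambda>A B. \<Union>u\<in>A. \<Union>w\<in>B. colim_class I leq D f (u @ w)),
     one = colim_class I leq D f []\<rparr>"

locale group_diagram =
  fixes I :: "'i set" and leq :: "'i \<Rightarrow> 'i \<Rightarrow> bool"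
    and D :: "'i \<Rightarrow> 'x monoid" and f :: "'i \<Rightarrow> 'i \<Rightarrow> 'x \<Rightarrow> 'x"
  assumes grp: "i \<in> I \<Longrightarrow> group (D i)"
    and hom: "i \<in> I \<Longrightarrow> j \<in> I \<Longrightarrow> leq i j \<Longrightarrow> f i j \<in> hom (D i) (D j)"
begin

abbreviation "W \<equiv> colim_words I D"
abbreviation "weq \<equiv> colim_eq I leq D f"
abbreviation "cls \<equiv> colim_class I leq D f"
abbreviation "C \<equiv> colim_group I leq D f"

lemma words_simps [simp]:
  "[] \<in> W"
  "p # w \<in> W \<longleftrightarrow> fst p \<in> I \<and> snd p \<in> carrier (D (fst p)) \<and> w \<in> W"
  "u @ w \<in> W \<longleftrightarrow> u \<in> W \<and> w \<in> W"
  by (cases p; auto simp: colim_words_def)+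

lemma eq_words: "weq u w \<Longrightarrow> u \<in> W \<and> w \<in> W"
proof (induction rule: colim_eq.induct)
  case (one i)
  then show ?case by (simp add: grp group.is_monoid monoid.one_closed)
next
  case (mult i x y)
  then show ?case by (simp add: grp group.is_monoid monoid.m_closed)
next
  case (map i j x)
  then show ?case using hom[of i j] by (auto simp: hom_def)
qed auto

lemma cls_eq_iff: "w \<in> W \<Longrightarrow> cls u = cls w \<longleftrightarrow> weq u w"
  unfolding colim_class_def
  by (auto intro: colim_eq.refl colim_eq.sym colim_eq.trans)

lemma mult_cls:
  assumes "u \<in> W" "w \<in> W"
  shows "cls u \<otimes>\<^bsub>C\<^esub> cls w = cls (u @ w)"
proof -
  have 1: "cls (u' @ w') = cls (u @ w)" if "weq u u'" "weq w w'" for u' w'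
    using that assms by (simp add: cls_eq_iff colim_eq.append colim_eq.sym)
  have "u \<in> cls u" "w \<in> cls w"
    using assms by (simp_all add: colim_class_def colim_eq.refl)
  then have "(\<Union>u'\<in>cls u. \<Union>w'\<in>cls w. cls (u' @ w')) = cls (u @ w)"
    using 1 unfolding colim_class_def[of I leq D f u] colim_class_def[of I leq D f w] by blast
  then show ?thesis by (simp add: colim_group_def)
qed

lemma carrier_C: "carrier C = cls ` W"
  and one_C: "\<one>\<^bsub>C\<^esub> = cls []"
  by (simp_all add: colim_group_def)

lemma left_inverse_word:
  assumes "w \<in> W"
  shows "\<exists>u\<in>W. weq (u @ w) []"
  using assms
proof (induction w)
  case Nil
  then show ?case using colim_eq.refl[of "[]" I D leq f] by (auto intro!: bexI[of _ "[]"])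
next
  case (Cons p w)
  obtain i x where p: "p = (i, x)" by force
  have i: "i \<in> I" and x: "x \<in> carrier (D i)" and w: "w \<in> W"
    using Cons.prems by (auto simp: p)
  interpret g: group "D i" using grp i .
  from Cons.IH[OF w] obtain u where u: "u \<in> W" "weq (u @ w) []" by blast
  let ?y = "inv\<^bsub>D i\<^esub> x"
  have "weq [(i, ?y), (i, x)] [(i, ?y \<otimes>\<^bsub>D i\<^esub> x)]"
    using i x by (intro colim_eq.mult) auto
  moreover have "weq [(i, ?y \<otimes>\<^bsub>D i\<^esub> x)] []"
    using colim_eq.one[of i I leq D f] i x by simp
  ultimately have "weq [(i, ?y), (i, x)] []" by (rule colim_eq.trans)
  then have "weq (u @ ([(i, ?y), (i, x)] @ w)) (u @ ([] @ w))"
    using u w by (intro colim_eq.append colim_eq.refl) auto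
  with u(2) have "weq (u @ ([(i, ?y), (i, x)] @ w)) []"
    by (auto intro: colim_eq.trans)
  then show ?case
    using u i x by (intro bexI[of _ "u @ [(i, ?y)]"]) (auto simp: p)
qed

lemma group_colim_group: "group C"
proof (rule groupI)
  fix x assume "x \<in> carrier C"
  then obtain w where w: "w \<in> W" "x = cls w" by (auto simp: carrier_C)
  from left_inverse_word[OF w(1)] obtain u where u: "u \<in> W" "weq (u @ w) []" by blast
  have "cls u \<otimes>\<^bsub>C\<^esub> x = \<one>\<^bsub>C\<^esub>"
    using u w by (simp add: mult_cls one_C cls_eq_iff)
  then show "\<exists>y\<in>carrier C. y \<otimes>\<^bsub>C\<^esub> x = \<one>\<^bsub>C\<^esub>"
    using u by (auto simp: carrier_C)
qed (auto simp: carrier_C one_C mult_cls)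

lemma colim_in_hom: "i \<in> I \<Longrightarrow> (\<lambda>x. cls [(i, x)]) \<in> hom (D i) C"
proof (rule homI)
  fix x y assume i: "i \<in> I" and x: "x \<in> carrier (D i)" and y: "y \<in> carrier (D i)"
  interpret g: group "D i" using grp i .
  show "cls [(i, x \<otimes>\<^bsub>D i\<^esub> y)] = cls [(i, x)] \<otimes>\<^bsub>C\<^esub> cls [(i, y)]"
    using i x y colim_eq.mult[of i I x D y leq f]
    by (simp add: mult_cls cls_eq_iff colim_eq.sym)
qed (auto simp: carrier_C)

lemma colim_in_compat:
  assumes "i \<in> I" "j \<in> I" "leq i j" "x \<in> carrier (D i)"
  shows "cls [(j, f i j x)] = cls [(i, x)]"
  using assms by (simp add: cls_eq_iff colim_eq.map colim_eq.sym)

lemma colim_group_universal: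
  fixes K :: "'k monoid" and \<phi> :: "'i \<Rightarrow> 'x \<Rightarrow> 'k"
  assumes K: "group K"
    and \<phi>: "\<And>i. i \<in> I \<Longrightarrow> \<phi> i \<in> hom (D i) K"
    and compat: "\<And>i j x. i \<in> I \<Longrightarrow> j \<in> I \<Longrightarrow> leq i j \<Longrightarrow> x \<in> carrier (D i) \<Longrightarrow> \<phi> j (f i j x) = \<phi> i x"
  shows "\<exists>!h. h \<in> hom C K \<and> h \<in> extensional (carrier C) \<and>
    (\<forall>i\<in>I. \<forall>x\<in>carrier (D i). h (cls [(i, x)]) = \<phi> i x)"
proof -
  interpret K: group K by fact
  define ev where "ev w = foldr (\<lambda>(i, x) k. \<phi> i x \<otimes>\<^bsub>K\<^esub> k) w \<one>\<^bsub>K\<^esub>" for w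
  have \<phi>_closed: "\<phi> i x \<in> carrier K" if "i \<in> I" "x \<in> carrier (D i)" for i x
    using \<phi>[OF that(1)] that(2) by (rule hom_in_carrier)
  have ev_closed: "ev w \<in> carrier K" if "w \<in> W" for w
    using that by (induction w) (auto simp: ev_def \<phi>_closed)
  have ev_append: "ev (u @ w) = ev u \<otimes>\<^bsub>K\<^esub> ev w" if "u \<in> W" "w \<in> W" for u w
    using that(1)
  proof (induction u)
    case Nil
    then show ?case using ev_closed[OF that(2)] by (simp add: ev_def)
  next
    case (Cons p u)
    then show ?case
      using ev_closed[of u] ev_closed[OF that(2)]
      by (auto simp: ev_def split_beta K.m_assoc \<phi>_closed)
  qed
  have ev_eq: "ev u = ev w" if "weq u w" for u w
    using that
  proof (induction rule: colim_eq.induct)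
    case (append u u' w w')
    then show ?case using ev_append eq_words by metis
  next
    case (one i)
    then show ?case using \<phi>[of i] hom_one[OF \<phi>[of i] grp K] by (simp add: ev_def)
  next
    case (mult i x y)
    then show ?case using hom_mult[OF \<phi>[of i]] by (simp add: ev_def \<phi>_closed)
  next
    case (map i j x)
    then show ?case by (simp add: ev_def compat)
  qed auto
  define h where "h = (\<lambda>A\<in>carrier C. ev (SOME w. w \<in> A))"
  have h_cls: "h (cls w) = ev w" if "w \<in> W" for w
  proof -
    have "w \<in> cls w" using that by (simp add: colim_class_def colim_eq.refl)
    then have "(SOME w'. w' \<in> cls w) \<in> cls w" by (rule someI)
    then have "weq w (SOME w'. w' \<in> cls w)" by (simp add: colim_class_def)
    from ev_eq[OF this] show ?thesis using that by (simp add: h_def carrier_C)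
  qed
  have h_ext: "h \<in> extensional (carrier C)" by (simp add: h_def)
  show ?thesis
  proof (rule ex1I[of _ h], intro conjI ballI)
    show "h \<in> hom C K"
      by (rule homI) (auto simp: carrier_C mult_cls h_cls ev_closed ev_append)
    show "h \<in> extensional (carrier C)" by (rule h_ext)
    show "h (cls [(i, x)]) = \<phi> i x" if "i \<in> I" "x \<in> carrier (D i)" for i x
      using that by (simp add: h_cls) (simp add: ev_def \<phi>_closed)
  next
    fix g assume g: "g \<in> hom C K \<and> g \<in> extensional (carrier C) \<and>
      (\<forall>i\<in>I. \<forall>x\<in>carrier (D i). g (cls [(i, x)]) = \<phi> i x)"
    have g_cls: "g (cls w) = ev w" if "w \<in> W" for w
      using that
    proof (induction w)
      case Nil
      show ?case using hom_one[OF _ group_colim_group K, of g] g by (simp add: one_C ev_def)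
    next
      case (Cons p w)
      have p: "[p] \<in> W" and w: "w \<in> W" using Cons.prems by auto
      have "cls (p # w) = cls [p] \<otimes>\<^bsub>C\<^esub> cls w" using mult_cls[OF p w] by simp
      then have "g (cls (p # w)) = g (cls [p]) \<otimes>\<^bsub>K\<^esub> g (cls w)"
        using g p w by (simp add: hom_mult carrier_C)
      then show ?case using Cons p g by (cases p) (auto simp: ev_def)
    qed
    show "g = h"
      by (rule extensionalityI[of _ "carrier C"]) (use g h_ext in \<open>auto simp: g_cls h_cls carrier_C\<close>)
  qed
qed

end


section \<open>Graph products\<close>

definition complete_subgraphs :: "'v set \<Rightarrow> 'v rel \<Rightarrow> 'v set set"
  where "complete_subgraphs V E = {S. S \<subseteq> V \<and> pairwise (\<lambda>v w. (v, w) \<in> E) S}"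

definition product_incl :: "('v \<Rightarrow> 'a monoid) \<Rightarrow> 'v set \<Rightarrow> 'v set \<Rightarrow> ('v \<Rightarrow> 'a) \<Rightarrow> 'v \<Rightarrow> 'a"
  where "product_incl G S T x = (\<lambda>v\<in>T. if v \<in> S then x v else \<one>\<^bsub>G v\<^esub>)"

definition graph_product ::
  "'v set \<Rightarrow> 'v rel \<Rightarrow> ('v \<Rightarrow> 'a monoid) \<Rightarrow> ('v set \<times> ('v \<Rightarrow> 'a)) list set monoid"
  where "graph_product V E G =
    colim_group (complete_subgraphs V E) (\<subseteq>) (\<lambda>S. product_group S G) (product_incl G)"

lemma group_diagram_graph_product:
  assumes "\<And>v. v \<in> V \<Longrightarrow> group (G v)"
  shows "group_diagram (complete_subgraphs V E) (\<subseteq>) (\<lambda>S. product_group S G) (product_incl G)"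
proof (rule group_diagram.intro)
  fix S assume "S \<in> complete_subgraphs V E"
  then show "group (product_group S G)"
    by (metis (no_types, lifting) assms complete_subgraphs_def mem_Collect_eq product_group subsetD)
next
  fix S T assume T: "T \<in> complete_subgraphs V E" and ST: "S \<subseteq> T"
  have gr: "group (G v)" if "v \<in> T" for v
    using that T assms by (auto simp: complete_subgraphs_def)
  have one: "\<one>\<^bsub>G v\<^esub> \<in> carrier (G v)" "\<one>\<^bsub>G v\<^esub> = \<one>\<^bsub>G v\<^esub> \<otimes>\<^bsub>G v\<^esub> \<one>\<^bsub>G v\<^esub>" if "v \<in> T" for v
    using gr[OF that] by (simp_all add: group.is_monoid)
  show "product_incl G S T \<in> hom (product_group S G) (product_group T G)"
    using ST one(1) by (intro homI) (auto simp: product_incl_def fun_eq_iff restrict_def intro: one(2))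
qed

lemma group_graph_product:
  "(\<And>v. v \<in> V \<Longrightarrow> group (G v)) \<Longrightarrow> group (graph_product V E G)"
  unfolding graph_product_def
  by (rule group_diagram.group_colim_group[OF group_diagram_graph_product])


section \<open>Strong commensurability\<close>

definition iso_to_subgroup_of_index :: "'h monoid \<Rightarrow> 'g monoid \<Rightarrow> nat \<Rightarrow> bool"
  where "iso_to_subgroup_of_index H G n \<longleftrightarrow>
    (\<exists>K. subgroup K G \<and> H \<cong> G\<lparr>carrier := K\<rparr> \<and> finite (rcosets\<^bsub>G\<^esub> K) \<and> card (rcosets\<^bsub>G\<^esub> K) = n)"

text \<open>
  \<open>strongly_commensurable_via H n G G'\<close>: the groups \<open>G\<close> and \<open>G'\<close> are strongly commensurable with
  common subgroup \<open>H\<close> and common (finite) index \<open>n = [G : H] = [G' : H]\<close>. The index is an explicit argument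
  because it is determined by the embeddings of \<open>H\<close>, not by the isomorphism type of \<open>H\<close>.
\<close>

definition strongly_commensurable_via :: "'h monoid \<Rightarrow> nat \<Rightarrow> 'g monoid \<Rightarrow> 'k monoid \<Rightarrow> bool"
  where "strongly_commensurable_via H n G G' \<longleftrightarrow>
    group H \<and> group G \<and> group G' \<and> iso_to_subgroup_of_index H G n \<and> iso_to_subgroup_of_index H G' n"

end

theory Submission
  imports Defs
begin

text \<open>
  The idea is to compare action groupoids. Each \<open>G\<^sub>v\<close> acts on the \<open>n\<^sub>v\<close> left cosets of \<open>H\<^sub>v\<close>, and after
  a choice of coset representatives the action groupoid becomes the product of the group \<open>H\<^sub>v\<close> with
  the groupoid on \<open>n\<^sub>v\<close> objects that has exactly one arrow between any two. This
  product does not remember \<open>G\<^sub>v\<close>, so \<open>G\<^sub>v\<close> and \<open>G'\<^sub>v\<close> have isomorphic action groupoids over the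
  same set of \<open>n\<^sub>v\<close> points, although the groups themselves need not be isomorphic.
  Such coordinates are built in \<open>ex_coset_coordinates\<close>.

  Let \<open>\<Omega>\<close> be the product of these finite sets over all vertices \<open>v\<close>. The actions on distinct coordinates
  commute, so each \<open>G\<^sub>S\<close> acts on \<open>\<Omega>\<close>, compatibly with the inclusions, and hence so does
  the graph product. The action is transitive, so the stabiliser of a point has index
  \<open>card \<Omega> = (\<Prod>v\<in>V. n v)\<close>. (For a suitable point it is the preimage of the product of the \<open>H\<^sub>v\<close> under the projection to the
  direct product of the \<open>G\<^sub>v\<close>.) The action groupoid of a colimit of groups is the colimit of the action groupoids.
  Those of \<open>G\<^sub>S\<close> and \<open>G'\<^sub>S\<close> are isomorphic, coordinate by coordinate and
  compatibly with the inclusions, so those of the two graph products are isomorphic by a map that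
  fixes \<open>\<Omega>\<close> pointwise. In particular the stabilisers of a point are isomorphic.

  On words the last argument needs no groupoids. An isomorphism of action groupoids over \<open>\<Omega>\<close> is a cocycle
  \<open>\<theta> S p g\<close>, which names the element of \<open>G'\<^sub>S\<close> that takes the place of \<open>g\<close> at the point \<open>p\<close>. A word is
  translated letter by letter, each letter at the point to which the letters on its right have moved the
  base point. The cocycle identities say precisely that translation respects the defining relations
  of the colimit (\<open>tr_cong\<close>), and translation by the inverse cocycle undoes it; this gives
  \<open>colim_stabilizers_isomorphic\<close>, which holds for arbitrary diagrams of groups.
\<close>

section \<open>Actions of a diagram of groups\<close>

lemma group_actionI:
  assumes G: "group G"
    and closed: "\<And>g x. g \<in> carrier G \<Longrightarrow> x \<in> \<Omega> \<Longrightarrow> act g x \<in> \<Omega>"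
    and one: "\<And>x. x \<in> \<Omega> \<Longrightarrow> act \<one>\<^bsub>G\<^esub> x = x"
    and mult: "\<And>g h x. g \<in> carrier G \<Longrightarrow> h \<in> carrier G \<Longrightarrow> x \<in> \<Omega>
      \<Longrightarrow> act (g \<otimes>\<^bsub>G\<^esub> h) x = act g (act h x)"
  shows "group_action G \<Omega> (\<lambda>g. \<lambda>x\<in>\<Omega>. act g x)"
proof -
  interpret G: group G by fact
  have bij: "(\<lambda>x\<in>\<Omega>. act g x) \<in> Bij \<Omega>" if g: "g \<in> carrier G" for g
  proof -
    have "act (inv\<^bsub>G\<^esub> g) (act g x) = x" "act g (act (inv\<^bsub>G\<^esub> g) x) = x" if "x \<in> \<Omega>" for x
      using mult[of "inv\<^bsub>G\<^esub> g" g x] mult[of g "inv\<^bsub>G\<^esub> g" x] g that one by simp_all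
    then have "bij_betw (act g) \<Omega> \<Omega>"
      using g closed by (intro bij_betw_byWitness[of _ "act (inv\<^bsub>G\<^esub> g)"]) auto
    then show ?thesis
      by (simp add: Bij_def cong: bij_betw_cong)
  qed
  have "(\<lambda>g. \<lambda>x\<in>\<Omega>. act g x) \<in> hom G (BijGroup \<Omega>)"
    by (rule homI)
      (auto simp: BijGroup_def bij compose_def closed mult intro!: restrict_ext)
  then show ?thesis
    by (simp add: group_action_def group_hom_def group_hom_axioms_def group_BijGroup G)
qed

definition word_act :: "('i \<Rightarrow> 'x \<Rightarrow> 'p \<Rightarrow> 'p) \<Rightarrow> ('i \<times> 'x) list \<Rightarrow> 'p \<Rightarrow> 'p"
  where "word_act act w p = foldr (\<lambda>(i, x). act i x) w p"

lemma word_act_simps [simp]: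
  "word_act act [] p = p"
  "word_act act ((i, x) # w) p = act i x (word_act act w p)"
  "word_act act (u @ w) p = word_act act u (word_act act w p)"
  by (simp_all add: word_act_def)

locale diagram_action = group_diagram I leq D f
  for I :: "'i set" and leq and D :: "'i \<Rightarrow> 'x monoid" and f +
  fixes \<Omega> :: "'p set" and act :: "'i \<Rightarrow> 'x \<Rightarrow> 'p \<Rightarrow> 'p"
  assumes action: "i \<in> I \<Longrightarrow> group_action (D i) \<Omega> (act i)"
    and compat: "i \<in> I \<Longrightarrow> j \<in> I \<Longrightarrow> leq i j \<Longrightarrow> x \<in> carrier (D i) \<Longrightarrow> act j (f i j x) = act i x"
begin

abbreviation "wact \<equiv> word_act act"

lemma act_closed: "i \<in> I \<Longrightarrow> x \<in> carrier (D i) \<Longrightarrow> p \<in> \<Omega> \<Longrightarrow> act i x p \<in> \<Omega>"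
  using group_action.element_image[OF action] by blast

lemma wact_closed: "w \<in> W \<Longrightarrow> p \<in> \<Omega> \<Longrightarrow> wact w p \<in> \<Omega>"
  by (induction w) (auto simp: act_closed)

text \<open>
  Compatible actions of the groups of a diagram are compatible homomorphisms into one
  symmetric group, so the universal property turns them into an action of the colimit.
\<close>

lemma ex_colim_action:
  obtains \<Phi> where "group_action C \<Omega> \<Phi>" and "\<And>w p. w \<in> W \<Longrightarrow> p \<in> \<Omega> \<Longrightarrow> \<Phi> (cls w) p = wact w p"
proof -
  have "\<exists>!h. h \<in> hom C (BijGroup \<Omega>) \<and> h \<in> extensional (carrier C) \<and>
      (\<forall>i\<in>I. \<forall>x\<in>carrier (D i). h (cls [(i, x)]) = act i x)"
    by (rule colim_group_universal)
      (use action compat in \<open>auto simp: group_BijGroup group_action_def group_hom_def group_hom_axioms_def\<close>)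
  then obtain \<Phi> where hom: "\<Phi> \<in> hom C (BijGroup \<Omega>)"
    and \<Phi>: "\<And>i x. i \<in> I \<Longrightarrow> x \<in> carrier (D i) \<Longrightarrow> \<Phi> (cls [(i, x)]) = act i x"
    by blast
  interpret \<Phi>: group_action C \<Omega> \<Phi>
    using hom group_colim_group by (simp add: group_action_def group_hom_def group_hom_axioms_def group_BijGroup)
  have "\<Phi> (cls w) p = wact w p" if "w \<in> W" "p \<in> \<Omega>" for w p
    using that(1)
  proof (induction w)
    case Nil
    show ?case using \<Phi>.id_eq_one that(2) by (metis one_C restrict_apply' word_act_simps(1))
  next
    case (Cons l w)
    obtain i x where l: "l = (i, x)" by force
    have "cls (l # w) = cls [l] \<otimes>\<^bsub>C\<^esub> cls w"
      using Cons.prems by (subst mult_cls) auto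
    then show ?case
      using Cons \<Phi>.composition_rule[OF that(2), of "cls [l]" "cls w"] \<Phi>[of i x]
      by (auto simp: l carrier_C)
  qed
  with \<Phi>.group_action_axioms that show ?thesis by blast
qed

lemma wact_cong: "weq u w \<Longrightarrow> p \<in> \<Omega> \<Longrightarrow> wact u p = wact w p"
  by (metis ex_colim_action eq_words cls_eq_iff)

definition colim_stabilizer :: "'p \<Rightarrow> ('i \<times> 'x) list set set"
  where "colim_stabilizer p = cls ` {w \<in> W. wact w p = p}"

lemma colim_stabilizer_eq:
  assumes "p \<in> \<Omega>" and "\<And>w. w \<in> W \<Longrightarrow> \<Phi> (cls w) p = wact w p"
  shows "stabilizer C \<Phi> p = colim_stabilizer p"
  using assms by (auto simp: stabilizer_def colim_stabilizer_def carrier_C)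

lemma subgroup_colim_stabilizer:
  assumes "p \<in> \<Omega>"
  shows "subgroup (colim_stabilizer p) C"
proof -
  obtain \<Phi> where "group_action C \<Omega> \<Phi>" "\<And>w. w \<in> W \<Longrightarrow> \<Phi> (cls w) p = wact w p"
    using ex_colim_action assms by metis
  then show ?thesis
    using group_action.stabilizer_subgroup colim_stabilizer_eq assms by metis
qed

text \<open>
  The conclusion is a bijection rather than an equality of cardinalities, so that finiteness of \<open>\<Omega>\<close> also
  yields finiteness of the index.
\<close>

lemma index_colim_stabilizer:
  assumes p: "p \<in> \<Omega>" and trans: "\<And>q. q \<in> \<Omega> \<Longrightarrow> \<exists>w\<in>W. wact w p = q"
  shows "\<exists>b. bij_betw b (rcosets\<^bsub>C\<^esub> (colim_stabilizer p)) \<Omega>"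
proof -
  obtain \<Phi> where \<Phi>: "group_action C \<Omega> \<Phi>" "\<And>w. w \<in> W \<Longrightarrow> \<Phi> (cls w) p = wact w p"
    using ex_colim_action assms by metis
  have "orbit C \<Phi> p = (\<lambda>w. wact w p) ` W"
    unfolding orbit_def carrier_C using \<Phi>(2) by (auto simp: image_iff) metis
  also have "\<dots> = \<Omega>"
    using trans wact_closed[OF _ p] by blast
  finally show ?thesis
    using group_action.orbit_stab_fun_is_bij[OF \<Phi>(1) p] colim_stabilizer_eq[where p = p and \<Phi> = \<Phi>, OF p \<Phi>(2)] by auto
qed

end

section \<open>Cocycles between actions\<close>

text \<open>
  Words act from right to left, so a letter meets the point to which the rest of the word
  has already moved \<open>p\<close>; that is the point at which its cocycle value is taken.
\<close>

primrec translate ::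
  "('i \<Rightarrow> 'x \<Rightarrow> 'p \<Rightarrow> 'p) \<Rightarrow> ('i \<Rightarrow> 'p \<Rightarrow> 'x \<Rightarrow> 'y) \<Rightarrow> 'p \<Rightarrow> ('i \<times> 'x) list \<Rightarrow> ('i \<times> 'y) list"
  where
    "translate act \<theta> p [] = []"
  | "translate act \<theta> p (l # w) =
      (fst l, \<theta> (fst l) (word_act act w p) (snd l)) # translate act \<theta> p w"

lemma translate_append:
  "translate act \<theta> p (u @ w) = translate act \<theta> (word_act act w p) u @ translate act \<theta> p w"
  by (induction u) auto

text \<open>
  A cocycle is a morphism of action groupoids that is the identity on points: it sends the
  arrow \<open>x : p \<rightarrow> act i x p\<close> to an arrow of the second diagram with the same end points, and it respects
  composition of arrows and the maps of the diagrams.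
\<close>

locale diagram_cocycle =
  src: diagram_action I leq D f \<Omega> act + tgt: diagram_action I leq D' f' \<Omega> act'
  for I :: "'i set" and leq and D :: "'i \<Rightarrow> 'x monoid" and f and D' :: "'i \<Rightarrow> 'y monoid" and f'
    and \<Omega> :: "'p set" and act act' +
  fixes \<theta> :: "'i \<Rightarrow> 'p \<Rightarrow> 'x \<Rightarrow> 'y"
  assumes \<theta>_closed: "i \<in> I \<Longrightarrow> p \<in> \<Omega> \<Longrightarrow> x \<in> carrier (D i) \<Longrightarrow> \<theta> i p x \<in> carrier (D' i)"
    and \<theta>_act: "i \<in> I \<Longrightarrow> p \<in> \<Omega> \<Longrightarrow> x \<in> carrier (D i) \<Longrightarrow> act' i (\<theta> i p x) p = act i x p"
    and \<theta>_mult: "i \<in> I \<Longrightarrow> p \<in> \<Omega> \<Longrightarrow> x \<in> carrier (D i) \<Longrightarrow> y \<in> carrier (D i)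
      \<Longrightarrow> \<theta> i p (x \<otimes>\<^bsub>D i\<^esub> y) = \<theta> i (act i y p) x \<otimes>\<^bsub>D' i\<^esub> \<theta> i p y"
    and \<theta>_map: "i \<in> I \<Longrightarrow> j \<in> I \<Longrightarrow> leq i j \<Longrightarrow> p \<in> \<Omega> \<Longrightarrow> x \<in> carrier (D i)
      \<Longrightarrow> \<theta> j p (f i j x) = f' i j (\<theta> i p x)"
begin

abbreviation "tr \<equiv> translate act \<theta>"

lemma \<theta>_one:
  assumes "i \<in> I" "p \<in> \<Omega>"
  shows "\<theta> i p \<one>\<^bsub>D i\<^esub> = \<one>\<^bsub>D' i\<^esub>"
proof -
  interpret D: group "D i" using src.grp assms(1) .
  interpret D': group "D' i" using tgt.grp assms(1) .
  interpret group_action "D i" \<Omega> "act i" using src.action assms(1) .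
  have "act i \<one>\<^bsub>D i\<^esub> p = p" using assms(2) id_eq_one by (metis restrict_apply')
  then have "\<theta> i p \<one>\<^bsub>D i\<^esub> \<otimes>\<^bsub>D' i\<^esub> \<theta> i p \<one>\<^bsub>D i\<^esub> = \<theta> i p \<one>\<^bsub>D i\<^esub>"
    using \<theta>_mult[OF assms, of "\<one>\<^bsub>D i\<^esub>" "\<one>\<^bsub>D i\<^esub>"] by simp
  then show ?thesis
    using \<theta>_closed[OF assms D.one_closed] by simp
qed

lemma tr_closed: "w \<in> src.W \<Longrightarrow> p \<in> \<Omega> \<Longrightarrow> tr p w \<in> tgt.W"
  by (induction w) (auto simp: \<theta>_closed src.wact_closed)

lemma wact_tr: "w \<in> src.W \<Longrightarrow> p \<in> \<Omega> \<Longrightarrow> tgt.wact (tr p w) p = src.wact w p"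
  by (induction w) (auto simp: \<theta>_act src.wact_closed)

text \<open>
  Each defining relation of the first colimit becomes the same relation of the second. For
  concatenation one needs that equivalent words move \<open>p\<close> to the same point, since the left factor is
  translated there.
\<close>

lemma tr_cong: "src.weq u w \<Longrightarrow> p \<in> \<Omega> \<Longrightarrow> tgt.weq (tr p u) (tr p w)"
proof (induction arbitrary: p rule: colim_eq.induct)
  case (refl w)
  then show ?case by (simp add: colim_eq.refl tr_closed)
next
  case (sym u w)
  then show ?case by (simp add: colim_eq.sym)
next
  case (trans u v w)
  then show ?case by (meson colim_eq.trans)
next
  case (append u u' w w')
  then show ?case
    using src.wact_cong[OF append.hyps(2) append.prems] src.eq_words[OF append.hyps(2)]
    by (simp add: translate_append colim_eq.append src.wact_closed)
next
  case (one i)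
  then show ?case by (simp add: \<theta>_one colim_eq.one)
next
  case (mult i x y)
  then show ?case
    by (simp add: \<theta>_mult colim_eq.mult \<theta>_closed src.act_closed)
next
  case (map i j x)
  then show ?case by (simp add: \<theta>_map colim_eq.map \<theta>_closed)
qed

end

text \<open>
  Translation is multiplicative only up to the change of base point in \<open>translate_append\<close>. On words that fix
  \<open>p\<close> the base point does not change, and translation becomes a homomorphism.
\<close>

theorem colim_stabilizers_isomorphic:
  assumes "diagram_cocycle I leq D f D' f' \<Omega> act act' \<theta>"
    and "diagram_cocycle I leq D' f' D f \<Omega> act' act \<theta>'"
    and inv: "\<And>i p x. i \<in> I \<Longrightarrow> p \<in> \<Omega> \<Longrightarrow> x \<in> carrier (D i) \<Longrightarrow> \<theta>' i p (\<theta> i p x) = x"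
    and inv': "\<And>i p y. i \<in> I \<Longrightarrow> p \<in> \<Omega> \<Longrightarrow> y \<in> carrier (D' i) \<Longrightarrow> \<theta> i p (\<theta>' i p y) = y"
    and p: "p \<in> \<Omega>"
  shows "(colim_group I leq D f)\<lparr>carrier := diagram_action.colim_stabilizer I leq D f act p\<rparr>
    \<cong> (colim_group I leq D' f')\<lparr>carrier := diagram_action.colim_stabilizer I leq D' f' act' p\<rparr>"
proof -
  interpret fw: diagram_cocycle I leq D f D' f' \<Omega> act act' \<theta> by fact
  interpret bw: diagram_cocycle I leq D' f' D f \<Omega> act' act \<theta>' by fact
  have bw_fw: "bw.tr p (fw.tr p w) = w" if "w \<in> fw.src.W" for w
    using that p by (induction w) (auto simp: fw.wact_tr fw.src.wact_closed inv)
  have fw_bw: "fw.tr p (bw.tr p w) = w" if "w \<in> fw.tgt.W" for w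
    using that p by (induction w) (auto simp: bw.wact_tr fw.tgt.wact_closed inv')
  \<comment> \<open>The choice of a representative is immaterial by \<open>tr_cong\<close>.\<close>
  define \<Theta> where "\<Theta> A = fw.tgt.cls (fw.tr p (SOME w. w \<in> A))" for A
  have \<Theta>: "\<Theta> (fw.src.cls w) = fw.tgt.cls (fw.tr p w)" if "w \<in> fw.src.W" for w
  proof -
    have "w \<in> fw.src.cls w" using that by (simp add: colim_class_def colim_eq.refl)
    then have "(SOME w'. w' \<in> fw.src.cls w) \<in> fw.src.cls w" by (rule someI)
    then have "fw.src.weq w (SOME w'. w' \<in> fw.src.cls w)" by (simp add: colim_class_def)
    from fw.tr_cong[OF this p] show ?thesis
      using that p by (simp add: \<Theta>_def fw.tgt.cls_eq_iff fw.tr_closed colim_eq.sym)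
  qed
  let ?K = "fw.src.colim_stabilizer p" and ?K' = "fw.tgt.colim_stabilizer p"
  have inj: "inj_on \<Theta> ?K"
  proof (rule inj_onI)
    fix A B assume "A \<in> ?K" "B \<in> ?K" and eq: "\<Theta> A = \<Theta> B"
    then obtain u w where uw: "u \<in> fw.src.W" "w \<in> fw.src.W" "A = fw.src.cls u" "B = fw.src.cls w"
      by (auto simp: fw.src.colim_stabilizer_def)
    with eq have "fw.tgt.weq (fw.tr p u) (fw.tr p w)"
      using p by (simp add: \<Theta> fw.tgt.cls_eq_iff fw.tr_closed)
    from bw.tr_cong[OF this p] show "A = B"
      using uw by (simp add: bw_fw fw.src.cls_eq_iff)
  qed
  have "\<Theta> A \<in> ?K'" if "A \<in> ?K" for A
    using that p by (auto simp: fw.src.colim_stabilizer_def fw.tgt.colim_stabilizer_def \<Theta>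
        fw.tr_closed fw.wact_tr)
  moreover have "A \<in> \<Theta> ` ?K" if A: "A \<in> ?K'" for A
  proof -
    obtain w where w: "w \<in> fw.tgt.W" "fw.tgt.wact w p = p" "A = fw.tgt.cls w"
      using A by (auto simp: fw.tgt.colim_stabilizer_def)
    then have "fw.src.cls (bw.tr p w) \<in> ?K"
      using p by (auto simp: fw.src.colim_stabilizer_def bw.tr_closed bw.wact_tr)
    moreover have "A = \<Theta> (fw.src.cls (bw.tr p w))"
      using w p by (simp add: \<Theta> bw.tr_closed fw_bw)
    ultimately show ?thesis by blast
  qed
  ultimately have "\<Theta> ` ?K = ?K'" by blast
  with inj have bij: "bij_betw \<Theta> ?K ?K'" by (simp add: bij_betw_def)
  have "\<Theta> (A \<otimes>\<^bsub>fw.src.C\<^esub> B) = \<Theta> A \<otimes>\<^bsub>fw.tgt.C\<^esub> \<Theta> B" if "A \<in> ?K" "B \<in> ?K" for A B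
    using that p by (auto simp: fw.src.colim_stabilizer_def fw.src.mult_cls fw.tgt.mult_cls \<Theta>
        fw.tr_closed translate_append)
  then have "\<Theta> \<in> iso (fw.src.C\<lparr>carrier := ?K\<rparr>) (fw.tgt.C\<lparr>carrier := ?K'\<rparr>)"
    using bij by (auto simp: iso_def hom_def bij_betw_def)
  then show ?thesis by (rule is_isoI)
qed

section \<open>The action of a group on the cosets of a finite-index subgroup\<close>

text \<open>
  An isomorphism from the action groupoid of \<open>G\<close> on \<open>n\<close> points to the product of the group \<open>H\<close> and the groupoid with
  exactly one arrow between any two of the points: the arrow \<open>g\<close> out of \<open>i\<close> is determined by its target \<open>a g i\<close> and
  its label \<open>c g i\<close>, both of which can be prescribed. The points are natural numbers so that two groups with
  the same \<open>H\<close> and \<open>n\<close> act on the same set.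
\<close>

locale coset_coordinates = G: group G + H: group H
  for G :: "'g monoid" and H :: "'h monoid" +
  fixes n :: nat and a :: "'g \<Rightarrow> nat \<Rightarrow> nat" and c :: "'g \<Rightarrow> nat \<Rightarrow> 'h"
  assumes n_pos: "0 < n"
    and a_mult: "g \<in> carrier G \<Longrightarrow> g' \<in> carrier G \<Longrightarrow> i < n \<Longrightarrow> a (g \<otimes>\<^bsub>G\<^esub> g') i = a g (a g' i)"
    and c_mult: "g \<in> carrier G \<Longrightarrow> g' \<in> carrier G \<Longrightarrow> i < n
      \<Longrightarrow> c (g \<otimes>\<^bsub>G\<^esub> g') i = c g (a g' i) \<otimes>\<^bsub>H\<^esub> c g' i"
    and bij: "i < n \<Longrightarrow> bij_betw (\<lambda>g. (a g i, c g i)) (carrier G) ({..<n} \<times> carrier H)"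
begin

lemma a_closed: "g \<in> carrier G \<Longrightarrow> i < n \<Longrightarrow> a g i < n"
  and c_closed: "g \<in> carrier G \<Longrightarrow> i < n \<Longrightarrow> c g i \<in> carrier H"
  using bij[THEN bij_betwE] by auto

lemma eqI:
  assumes "a g i = a g' i" "c g i = c g' i" "g \<in> carrier G" "g' \<in> carrier G" "i < n"
  shows "g = g'"
  using bij_betw_imp_inj_on[OF bij[OF assms(5)]] assms(1-4) by (auto dest: inj_onD)

lemma transitive:
  assumes "i < n" "j < n"
  shows "\<exists>g\<in>carrier G. a g i = j"
proof -
  have "(j, \<one>\<^bsub>H\<^esub>) \<in> (\<lambda>g. (a g i, c g i)) ` carrier G"
    using bij_betw_imp_surj_on[OF bij[OF assms(1)]] assms(2) by simp
  then show ?thesis by auto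
qed

lemma a_one:
  assumes "i < n"
  shows "a \<one>\<^bsub>G\<^esub> i = i"
proof -
  obtain g where "g \<in> carrier G" "a g i = i" using transitive assms by blast
  then show ?thesis using a_mult[of "\<one>\<^bsub>G\<^esub>" g i] assms by simp
qed

lemma c_one:
  assumes "i < n"
  shows "c \<one>\<^bsub>G\<^esub> i = \<one>\<^bsub>H\<^esub>"
  using c_mult[of "\<one>\<^bsub>G\<^esub>" "\<one>\<^bsub>G\<^esub>" i] c_closed[of "\<one>\<^bsub>G\<^esub>" i] a_one[of i] assms by simp

end

text \<open>
  Let \<open>\<phi>\<close> embed \<open>H\<close> as \<open>K\<close> and let \<open>s\<^sub>j\<close> represent the left cosets of \<open>K\<close>. Then
  \<open>\<sigma> (j, h) = s\<^sub>j \<phi>(h)\<close> identifies \<open>{..<n} \<times> H\<close> with \<open>G\<close>, and \<open>a\<close> and \<open>c\<close> are read off from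
  \<open>g s\<^sub>i = s\<^sub>j \<phi>(h)\<close> as \<open>j = a g i\<close> and \<open>h = c g i\<close>. Moving \<open>g g'\<close> past \<open>s\<^sub>i\<close> one factor at a time gives the
  cocycle identity. The index is given in terms of right cosets \<open>K t\<^sub>j\<close>, whose inverses are the left cosets, so
  \<open>s\<^sub>j\<close> is the inverse of \<open>t\<^sub>j\<close>.
\<close>

lemma ex_coset_coordinates:
  assumes G: "group G" and H: "group H" and index: "iso_to_subgroup_of_index H G n"
  shows "\<exists>a c. coset_coordinates G H n a c"
proof -
  interpret G: group G by fact
  interpret H: group H by fact
  obtain K where K: "subgroup K G" and iso: "H \<cong> G\<lparr>carrier := K\<rparr>"
    and fin: "finite (rcosets\<^bsub>G\<^esub> K)" and card: "card (rcosets\<^bsub>G\<^esub> K) = n"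
    using index unfolding iso_to_subgroup_of_index_def by blast
  interpret K: subgroup K G by fact
  obtain \<phi> where "\<phi> \<in> iso H (G\<lparr>carrier := K\<rparr>)"
    using iso unfolding is_iso_def by blast
  then have \<phi>: "bij_betw \<phi> (carrier H) K"
    and \<phi>_mult: "\<And>h h'. h \<in> carrier H \<Longrightarrow> h' \<in> carrier H \<Longrightarrow> \<phi> (h \<otimes>\<^bsub>H\<^esub> h') = \<phi> h \<otimes>\<^bsub>G\<^esub> \<phi> h'"
    by (auto simp: iso_def hom_def)
  have \<phi>_K: "\<phi> h \<in> K" if "h \<in> carrier H" for h
    using bij_betwE[OF \<phi>] that by blast
  have \<phi>_closed: "\<phi> h \<in> carrier G" if "h \<in> carrier H" for h
    using \<phi>_K[OF that] by simp
  obtain b where b: "bij_betw b {..<n} (rcosets\<^bsub>G\<^esub> K)"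
    using finite_same_card_bij[of "{..<n}" "rcosets\<^bsub>G\<^esub> K"] fin card by auto
  have "\<exists>t\<in>carrier G. b i = K #>\<^bsub>G\<^esub> t" if "i < n" for i
    using bij_betwE[OF b] that by (auto simp: RCOSETS_def)
  then obtain t where t: "\<And>i. i < n \<Longrightarrow> t i \<in> carrier G" "\<And>i. i < n \<Longrightarrow> b i = K #>\<^bsub>G\<^esub> t i"
    by metis
  define \<sigma> where "\<sigma> = (\<lambda>(j, h). inv\<^bsub>G\<^esub> t j \<otimes>\<^bsub>G\<^esub> \<phi> h)"
  have \<sigma>_closed: "\<sigma> (j, h) \<in> carrier G" if "j < n" "h \<in> carrier H" for j h
    using that t \<phi>_closed by (simp add: \<sigma>_def)
  have inj: "inj_on \<sigma> ({..<n} \<times> carrier H)"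
  proof (rule inj_onI, clarify)
    fix j h j' h' assume j: "j < n" "j' < n" and h: "h \<in> carrier H" "h' \<in> carrier H"
      and eq: "\<sigma> (j, h) = \<sigma> (j', h')"
    have "t j' \<otimes>\<^bsub>G\<^esub> inv\<^bsub>G\<^esub> t j = t j' \<otimes>\<^bsub>G\<^esub> (\<sigma> (j, h) \<otimes>\<^bsub>G\<^esub> inv\<^bsub>G\<^esub> \<phi> h)"
      using j h t \<phi>_closed by (simp add: \<sigma>_def G.m_assoc)
    also have "\<dots> = t j' \<otimes>\<^bsub>G\<^esub> (\<sigma> (j', h') \<otimes>\<^bsub>G\<^esub> inv\<^bsub>G\<^esub> \<phi> h)"
      by (simp add: eq)
    also have "\<dots> = \<phi> h' \<otimes>\<^bsub>G\<^esub> inv\<^bsub>G\<^esub> \<phi> h"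
      using j h t \<phi>_closed by (simp add: \<sigma>_def G.m_assoc[symmetric])
    also have "\<dots> \<in> K"
      using h \<phi>_K by simp
    finally have "t j' \<in> K #>\<^bsub>G\<^esub> t j"
      using j t K.rcos_module[OF G] by simp
    then have "b j = b j'"
      using j t K by (simp add: G.repr_independence)
    then have jj: "j = j'"
      using bij_betw_imp_inj_on[OF b] j by (auto dest: inj_onD)
    with eq have "\<phi> h = \<phi> h'"
      using j h t \<phi>_closed by (simp add: \<sigma>_def)
    then have "h = h'"
      using bij_betw_imp_inj_on[OF \<phi>] h by (auto dest: inj_onD)
    with jj show "j = j' \<and> h = h'" by simp
  qed
  have surj: "g \<in> \<sigma> ` ({..<n} \<times> carrier H)" if g: "g \<in> carrier G" for g
  proof -
    have "K #>\<^bsub>G\<^esub> inv\<^bsub>G\<^esub> g \<in> rcosets\<^bsub>G\<^esub> K"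
      using g K.subset by (intro G.rcosetsI) auto
    then obtain j where j: "j < n" "K #>\<^bsub>G\<^esub> inv\<^bsub>G\<^esub> g = K #>\<^bsub>G\<^esub> t j"
      using t(2) unfolding bij_betw_imp_surj_on[OF b, symmetric] by auto
    have "t j \<in> K #>\<^bsub>G\<^esub> inv\<^bsub>G\<^esub> g"
      unfolding j(2) by (rule G.rcos_self[OF t(1)[OF j(1)] K])
    then have "t j \<otimes>\<^bsub>G\<^esub> g \<in> K"
      using g j t K.rcos_module[OF G, of "inv\<^bsub>G\<^esub> g" "t j"] by simp
    then have "t j \<otimes>\<^bsub>G\<^esub> g \<in> \<phi> ` carrier H"
      by (simp add: bij_betw_imp_surj_on[OF \<phi>])
    then obtain h where h: "h \<in> carrier H" "t j \<otimes>\<^bsub>G\<^esub> g = \<phi> h"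
      by blast
    then have "\<sigma> (j, h) = g"
      using g j t by (simp add: \<sigma>_def h(2)[symmetric] G.m_assoc[symmetric])
    with j h show ?thesis by (intro image_eqI[of _ _ "(j, h)"]) auto
  qed
  have \<sigma>: "bij_betw \<sigma> ({..<n} \<times> carrier H) (carrier G)"
    using inj \<sigma>_closed surj by (auto simp: bij_betw_def)
  define \<kappa> where "\<kappa> = inv_into ({..<n} \<times> carrier H) \<sigma>"
  have \<kappa>: "bij_betw \<kappa> (carrier G) ({..<n} \<times> carrier H)"
    unfolding \<kappa>_def by (rule bij_betw_inv_into[OF \<sigma>])
  have \<sigma>_\<kappa>: "\<sigma> (\<kappa> g) = g" if "g \<in> carrier G" for g
    unfolding \<kappa>_def using that by (rule bij_betw_inv_into_right[OF \<sigma>])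
  define a where "a g i = fst (\<kappa> (g \<otimes>\<^bsub>G\<^esub> inv\<^bsub>G\<^esub> t i))" for g i
  define c where "c g i = snd (\<kappa> (g \<otimes>\<^bsub>G\<^esub> inv\<^bsub>G\<^esub> t i))" for g i
  have ac: "bij_betw (\<lambda>g. (a g i, c g i)) (carrier G) ({..<n} \<times> carrier H)" if i: "i < n" for i
  proof -
    have "bij_betw (\<lambda>g. g \<otimes>\<^bsub>G\<^esub> inv\<^bsub>G\<^esub> t i) (carrier G) (carrier G)"
      using t(1)[OF i]
      by (intro bij_betw_byWitness[where f' = "\<lambda>g. g \<otimes>\<^bsub>G\<^esub> t i"]) (auto simp: G.m_assoc)
    from bij_betw_trans[OF this \<kappa>] show ?thesis
      by (simp add: a_def c_def o_def)
  qed
  have ac_closed: "a g i < n" "c g i \<in> carrier H" if "g \<in> carrier G" "i < n" for g i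
    using bij_betwE[OF ac[OF that(2)]] that(1) by auto
  have \<sigma>_ac: "inv\<^bsub>G\<^esub> t (a g i) \<otimes>\<^bsub>G\<^esub> \<phi> (c g i) = g \<otimes>\<^bsub>G\<^esub> inv\<^bsub>G\<^esub> t i" if "g \<in> carrier G" "i < n" for g i
    using \<sigma>_\<kappa>[of "g \<otimes>\<^bsub>G\<^esub> inv\<^bsub>G\<^esub> t i"] that t(1) by (simp add: a_def c_def \<sigma>_def split_beta)
  have mult: "a (g \<otimes>\<^bsub>G\<^esub> g') i = a g (a g' i) \<and> c (g \<otimes>\<^bsub>G\<^esub> g') i = c g (a g' i) \<otimes>\<^bsub>H\<^esub> c g' i"
    if g: "g \<in> carrier G" "g' \<in> carrier G" and i: "i < n" for g g' i
  proof -
    let ?j = "a g' i"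
    have j: "?j < n" and k: "a g ?j < n" using ac_closed g i by auto
    have h: "c g' i \<in> carrier H" "c g ?j \<in> carrier H" using ac_closed g i j by auto
    have "\<sigma> (a g ?j, c g ?j \<otimes>\<^bsub>H\<^esub> c g' i) = (inv\<^bsub>G\<^esub> t (a g ?j) \<otimes>\<^bsub>G\<^esub> \<phi> (c g ?j)) \<otimes>\<^bsub>G\<^esub> \<phi> (c g' i)"
      using h k t(1) by (simp add: \<sigma>_def \<phi>_mult \<phi>_closed G.m_assoc)
    also have "\<dots> = g \<otimes>\<^bsub>G\<^esub> (inv\<^bsub>G\<^esub> t ?j \<otimes>\<^bsub>G\<^esub> \<phi> (c g' i))"
      using h j g t(1) by (simp add: \<sigma>_ac \<phi>_closed G.m_assoc)
    also have "\<dots> = \<sigma> (a (g \<otimes>\<^bsub>G\<^esub> g') i, c (g \<otimes>\<^bsub>G\<^esub> g') i)"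
      using g i t(1) by (simp add: \<sigma>_ac \<sigma>_def G.m_assoc)
    finally have "(a g ?j, c g ?j \<otimes>\<^bsub>H\<^esub> c g' i) = (a (g \<otimes>\<^bsub>G\<^esub> g') i, c (g \<otimes>\<^bsub>G\<^esub> g') i)"
      by (rule inj_onD[OF inj]) (use ac_closed[of "g \<otimes>\<^bsub>G\<^esub> g'" i] g i h k in auto)
    then show ?thesis by simp
  qed
  have "rcosets\<^bsub>G\<^esub> K \<noteq> {}"
    using G.rcosetsI[OF K.subset G.one_closed] by blast
  then have "0 < n"
    using fin card by (metis card_gt_0_iff)
  then have "coset_coordinates G H n a c"
    using mult ac by unfold_locales auto
  then show ?thesis by blast
qed

text \<open>
  The composite of the coordinates of \<open>G\<close> with the inverse of those of \<open>G'\<close>: the arrow of \<open>G'\<close> out of \<open>i\<close> with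
  the same target and label as \<open>g\<close>.
\<close>

definition coset_transfer ::
  "'k monoid \<Rightarrow> ('k \<Rightarrow> nat \<Rightarrow> nat) \<Rightarrow> ('k \<Rightarrow> nat \<Rightarrow> 'h) \<Rightarrow> ('g \<Rightarrow> nat \<Rightarrow> nat) \<Rightarrow> ('g \<Rightarrow> nat \<Rightarrow> 'h)
    \<Rightarrow> nat \<Rightarrow> 'g \<Rightarrow> 'k"
  where "coset_transfer G' a' c' a c i g =
    inv_into (carrier G') (\<lambda>g'. (a' g' i, c' g' i)) (a g i, c g i)"

locale coset_coordinates_pair =
  src: coset_coordinates G H n a c + tgt: coset_coordinates G' H n a' c'
  for G :: "'g monoid" and G' :: "'k monoid" and H :: "'h monoid" and n a c a' c'
begin

abbreviation "\<tau> \<equiv> coset_transfer G' a' c' a c"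
abbreviation "\<tau>' \<equiv> coset_transfer G a c a' c'"

lemma transfer:
  assumes "g \<in> carrier G" "i < n"
  shows transfer_closed: "\<tau> i g \<in> carrier G'"
    and a_transfer: "a' (\<tau> i g) i = a g i"
    and c_transfer: "c' (\<tau> i g) i = c g i"
proof -
  have mem: "(a g i, c g i) \<in> (\<lambda>g'. (a' g' i, c' g' i)) ` carrier G'"
    using bij_betw_imp_surj_on[OF tgt.bij] assms by (simp add: src.a_closed src.c_closed)
  show "\<tau> i g \<in> carrier G'"
    using inv_into_into[OF mem] by (simp add: coset_transfer_def)
  show "a' (\<tau> i g) i = a g i" "c' (\<tau> i g) i = c g i"
    using f_inv_into_f[OF mem] by (simp_all add: coset_transfer_def)
qed

lemma transfer_mult:
  assumes "g \<in> carrier G" "g' \<in> carrier G" "i < n"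
  shows "\<tau> i (g \<otimes>\<^bsub>G\<^esub> g') = \<tau> (a g' i) g \<otimes>\<^bsub>G'\<^esub> \<tau> i g'"
  using assms
  by (intro tgt.eqI[of _ i])
    (auto simp: transfer tgt.a_mult tgt.c_mult src.a_mult src.c_mult src.a_closed)

lemma transfer_one: "i < n \<Longrightarrow> \<tau> i \<one>\<^bsub>G\<^esub> = \<one>\<^bsub>G'\<^esub>"
  by (intro tgt.eqI[of _ i]) (auto simp: transfer src.a_one src.c_one tgt.a_one tgt.c_one)

lemma transfer_transfer: "g \<in> carrier G \<Longrightarrow> i < n \<Longrightarrow> \<tau>' i (\<tau> i g) = g"
  unfolding coset_transfer_def[of G] using bij_betw_imp_inj_on[OF src.bij[of i]]
  by (simp add: transfer inv_into_f_f[where f = "\<lambda>g. (a g i, c g i)"])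

end

section \<open>Graph products\<close>

abbreviation point_space :: "'v set \<Rightarrow> ('v \<Rightarrow> nat) \<Rightarrow> ('v \<Rightarrow> nat) set"
  where "point_space V n \<equiv> (\<Pi>\<^sub>E v\<in>V. {..<n v})"

text \<open>
  Restricting to the point space makes these functions elements of \<open>BijGroup\<close>, which contains only extensional ones.
\<close>

definition coordinate_act ::
  "'v set \<Rightarrow> ('v \<Rightarrow> nat) \<Rightarrow> ('v \<Rightarrow> 'a \<Rightarrow> nat \<Rightarrow> nat) \<Rightarrow> 'v set \<Rightarrow> ('v \<Rightarrow> 'a)
    \<Rightarrow> ('v \<Rightarrow> nat) \<Rightarrow> 'v \<Rightarrow> nat"
  where "coordinate_act V n a S g =
    (\<lambda>p\<in>point_space V n. \<lambda>v\<in>V. if v \<in> S then a v (g v) (p v) else p v)"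

lemma diagram_action_graph_product:
  assumes coord: "\<And>v. v \<in> V \<Longrightarrow> coset_coordinates (G v) (H v) (n v) (a v) (c v)"
  shows "diagram_action (complete_subgraphs V E) (\<subseteq>) (\<lambda>S. product_group S G) (product_incl G)
    (point_space V n) (coordinate_act V n a)"
proof -
  have G: "group (G v)" if "v \<in> V" for v
    using coord[OF that] by (simp add: coset_coordinates_def)
  note a_closed = coset_coordinates.a_closed[OF coord]
    and a_one = coset_coordinates.a_one[OF coord]
    and a_mult = coset_coordinates.a_mult[OF coord]
  interpret group_diagram "complete_subgraphs V E" "(\<subseteq>)" "\<lambda>S. product_group S G" "product_incl G"
    by (rule group_diagram_graph_product[OF G])
  show ?thesis
  proof (intro diagram_action.intro diagram_action_axioms.intro group_diagram_axioms)
    fix S assume S: "S \<in> complete_subgraphs V E"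
    then have "S \<subseteq> V" by (simp add: complete_subgraphs_def)
    then show "group_action (product_group S G) (point_space V n) (coordinate_act V n a S)"
      unfolding coordinate_act_def
      by (intro group_actionI grp[OF S])
        (auto simp: a_closed a_one a_mult subset_iff PiE_iff extensional_def fun_eq_iff
          split: if_splits)
  next
    fix S T g assume S: "S \<in> complete_subgraphs V E" "T \<in> complete_subgraphs V E" "S \<subseteq> T"
      and g: "g \<in> carrier (product_group S G)"
    then show "coordinate_act V n a T (product_incl G S T g) = coordinate_act V n a S g"
      unfolding coordinate_act_def product_incl_def
      by (intro restrict_ext) (auto simp: a_one PiE_iff)
  qed
qed

definition coordinate_transfer ::
  "('v \<Rightarrow> nat \<Rightarrow> 'a \<Rightarrow> 'b) \<Rightarrow> 'v set \<Rightarrow> ('v \<Rightarrow> nat) \<Rightarrow> ('v \<Rightarrow> 'a) \<Rightarrow> 'v \<Rightarrow> 'b"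
  where "coordinate_transfer \<tau> S p g = (\<lambda>v\<in>S. \<tau> v (p v) (g v))"

lemma diagram_cocycle_graph_product:
  assumes coord: "\<And>v. v \<in> V \<Longrightarrow> coset_coordinates (G v) (H v) (n v) (a v) (c v)"
    and coord': "\<And>v. v \<in> V \<Longrightarrow> coset_coordinates (G' v) (H v) (n v) (a' v) (c' v)"
  shows "diagram_cocycle (complete_subgraphs V E) (\<subseteq>)
    (\<lambda>S. product_group S G) (product_incl G) (\<lambda>S. product_group S G') (product_incl G')
    (point_space V n) (coordinate_act V n a) (coordinate_act V n a')
    (coordinate_transfer (\<lambda>v. coset_transfer (G' v) (a' v) (c' v) (a v) (c v)))"
proof -
  have pair: "coset_coordinates_pair (G v) (G' v) (H v) (n v) (a v) (c v) (a' v) (c' v)"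
    if "v \<in> V" for v
    using coord[OF that] coord'[OF that] by (simp add: coset_coordinates_pair_def)
  note \<tau> = coset_coordinates_pair.transfer[OF pair]
    and \<tau>_mult = coset_coordinates_pair.transfer_mult[OF pair]
    and \<tau>_one = coset_coordinates_pair.transfer_one[OF pair]
  let ?\<Omega> = "point_space V n"
  let ?\<theta> = "coordinate_transfer (\<lambda>v. coset_transfer (G' v) (a' v) (c' v) (a v) (c v))"
  have sub: "v \<in> V" if "S \<in> complete_subgraphs V E" "v \<in> S" for S v
    using that by (auto simp: complete_subgraphs_def)
  show ?thesis
  proof (intro diagram_cocycle.intro diagram_cocycle_axioms.intro
      diagram_action_graph_product[OF coord] diagram_action_graph_product[OF coord'])
    fix S p g assume S: "S \<in> complete_subgraphs V E" and p: "p \<in> ?\<Omega>"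
      and g: "g \<in> carrier (product_group S G)"
    show "?\<theta> S p g \<in> carrier (product_group S G')"
      using sub[OF S] p g by (auto simp: coordinate_transfer_def \<tau> PiE_iff)
    show "coordinate_act V n a' S (?\<theta> S p g) p = coordinate_act V n a S g p"
      using sub[OF S] p g by (auto simp: coordinate_act_def coordinate_transfer_def \<tau> PiE_iff)
    fix g' assume g': "g' \<in> carrier (product_group S G)"
    show "?\<theta> S p (g \<otimes>\<^bsub>product_group S G\<^esub> g') =
        ?\<theta> S (coordinate_act V n a S g' p) g \<otimes>\<^bsub>product_group S G'\<^esub> ?\<theta> S p g'"
      using sub[OF S] p g g'
      by (auto simp: coordinate_act_def coordinate_transfer_def \<tau>_mult PiE_iff)
  next
    fix S T p g assume "S \<in> complete_subgraphs V E" and T: "T \<in> complete_subgraphs V E"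
      and "S \<subseteq> T" and p: "p \<in> ?\<Omega>" and g: "g \<in> carrier (product_group S G)"
    then show "?\<theta> T p (product_incl G S T g) = product_incl G' S T (?\<theta> S p g)"
      using sub[OF T]
      by (auto simp: coordinate_transfer_def product_incl_def \<tau>_one PiE_iff)
  qed
qed

text \<open>
  The coordinates are corrected one vertex at a time, by letters supported on single vertices; these are available
  in every graph because singletons are complete.
\<close>

lemma transitive_graph_product:
  assumes coord: "\<And>v. v \<in> V \<Longrightarrow> coset_coordinates (G v) (H v) (n v) (a v) (c v)"
    and V: "finite V" and p: "p \<in> point_space V n" and q: "q \<in> point_space V n"
  shows "\<exists>w\<in>colim_words (complete_subgraphs V E) (\<lambda>S. product_group S G).
    word_act (coordinate_act V n a) w p = q"
proof -
  interpret diagram_action "complete_subgraphs V E" "(\<subseteq>)" "\<lambda>S. product_group S G" "product_incl G"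
    "point_space V n" "coordinate_act V n a"
    by (rule diagram_action_graph_product[OF coord])
  have "\<exists>w\<in>W. wact w p = (\<lambda>v\<in>V. if v \<in> A then q v else p v)" if "finite A" "A \<subseteq> V" for A
    using that
  proof (induction A rule: finite_induct)
    case empty
    show ?case
      using p by (intro bexI[of _ "[]"]) (auto simp: PiE_iff extensional_def fun_eq_iff)
  next
    case (insert u A)
    let ?r = "\<lambda>v\<in>V. if v \<in> A then q v else p v"
    obtain w where w: "w \<in> W" "wact w p = ?r" using insert by blast
    have r: "?r \<in> point_space V n" using p q by auto
    obtain g where g: "g \<in> carrier (G u)" "a u g (p u) = q u"
      using coset_coordinates.transitive[OF coord, of u "p u" "q u"] insert.prems p q by auto
    let ?l = "({u}, \<lambda>v\<in>{u}. g)"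
    have "{u} \<in> complete_subgraphs V E"
      using insert.prems by (simp add: complete_subgraphs_def)
    then have "?l # w \<in> W"
      using w g by auto
    moreover have "wact (?l # w) p = (\<lambda>v\<in>V. if v \<in> insert u A then q v else p v)"
      using w r g insert.hyps insert.prems by (auto simp: coordinate_act_def fun_eq_iff)
    ultimately show ?case by blast
  qed
  from this[OF V] obtain w where "w \<in> W" "wact w p = (\<lambda>v\<in>V. q v)"
    by (auto cong: restrict_cong)
  moreover have "(\<lambda>v\<in>V. q v) = q"
    using q by (auto simp: PiE_iff extensional_restrict)
  ultimately show ?thesis by auto
qed

text \<open>
  \<open>L\<close> is given only up to isomorphism because one group, the stabiliser in the first graph product, is to be
  found in both graph products.
\<close>

lemma index_graph_product_stabilizer:
  assumes coord: "\<And>v. v \<in> V \<Longrightarrow> coset_coordinates (G v) (H v) (n v) (a v) (c v)"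
    and V: "finite V" and p: "p \<in> point_space V n"
    and K: "K = diagram_action.colim_stabilizer (complete_subgraphs V E) (\<subseteq>)
      (\<lambda>S. product_group S G) (product_incl G) (coordinate_act V n a) p"
    and L: "L \<cong> (graph_product V E G)\<lparr>carrier := K\<rparr>"
  shows "iso_to_subgroup_of_index L (graph_product V E G) (\<Prod>v\<in>V. n v)"
proof -
  interpret diagram_action "complete_subgraphs V E" "(\<subseteq>)" "\<lambda>S. product_group S G" "product_incl G"
    "point_space V n" "coordinate_act V n a"
    by (rule diagram_action_graph_product[OF coord])
  obtain b where b: "bij_betw b (rcosets\<^bsub>C\<^esub> K) (point_space V n)"
    using index_colim_stabilizer[OF p] transitive_graph_product[OF coord V p] unfolding K by blast
  have "finite (point_space V n)" "card (point_space V n) = (\<Prod>v\<in>V. n v)"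
    using V by (simp_all add: finite_PiE card_PiE)
  then have "finite (rcosets\<^bsub>C\<^esub> K)" "card (rcosets\<^bsub>C\<^esub> K) = (\<Prod>v\<in>V. n v)"
    using bij_betw_finite[OF b] bij_betw_same_card[OF b] by simp_all
  moreover have "subgroup K C" unfolding K by (rule subgroup_colim_stabilizer[OF p])
  ultimately show ?thesis
    using L by (auto simp: iso_to_subgroup_of_index_def graph_product_def)
qed

lemma coordinate_transfer_inverse:
  assumes coord: "\<And>v. v \<in> V \<Longrightarrow> coset_coordinates (G v) (H v) (n v) (a v) (c v)"
    and coord': "\<And>v. v \<in> V \<Longrightarrow> coset_coordinates (G' v) (H v) (n v) (a' v) (c' v)"
    and "S \<in> complete_subgraphs V E" "p \<in> point_space V n" "g \<in> carrier (product_group S G)"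
  shows "coordinate_transfer (\<lambda>v. coset_transfer (G v) (a v) (c v) (a' v) (c' v)) S p
    (coordinate_transfer (\<lambda>v. coset_transfer (G' v) (a' v) (c' v) (a v) (c v)) S p g) = g"
proof
  fix v
  show "coordinate_transfer (\<lambda>v. coset_transfer (G v) (a v) (c v) (a' v) (c' v)) S p
    (coordinate_transfer (\<lambda>v. coset_transfer (G' v) (a' v) (c' v) (a v) (c v)) S p g) v = g v"
  proof (cases "v \<in> S")
    case True
    then have v: "v \<in> V" using assms(3) by (auto simp: complete_subgraphs_def)
    interpret coset_coordinates_pair "G v" "G' v" "H v" "n v" "a v" "c v" "a' v" "c' v"
      using coord[OF v] coord'[OF v] by (simp add: coset_coordinates_pair_def)
    show ?thesis
      using True v assms(4,5) by (auto simp: coordinate_transfer_def transfer_transfer PiE_iff)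
  next
    case False
    then show ?thesis
      using assms(5) by (auto simp: coordinate_transfer_def PiE_iff extensional_def)
  qed
qed

theorem theorem1:
  fixes V :: "'v set" and E :: "'v rel"
    and G :: "'v \<Rightarrow> 'a monoid" and G' :: "'v \<Rightarrow> 'b monoid" and H :: "'v \<Rightarrow> 'c monoid"
    and n :: "'v \<Rightarrow> nat"
  assumes "finite V" and "E \<subseteq> V \<times> V" and "irrefl E" and "sym E"
    and "\<And>v. v \<in> V \<Longrightarrow> strongly_commensurable_via (H v) (n v) (G v) (G' v)"
  shows "\<exists>K :: ('v set \<times> ('v \<Rightarrow> 'a)) list set monoid.
    strongly_commensurable_via K (\<Prod>v\<in>V. n v) (graph_product V E G) (graph_product V E G')"
proof -
  note sc = assms(5)[unfolded strongly_commensurable_via_def]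
  have "\<exists>a c. coset_coordinates (G v) (H v) (n v) a c" if "v \<in> V" for v
    using sc[OF that] ex_coset_coordinates by blast
  then obtain a c where coord: "\<And>v. v \<in> V \<Longrightarrow> coset_coordinates (G v) (H v) (n v) (a v) (c v)"
    by metis
  have "\<exists>a c. coset_coordinates (G' v) (H v) (n v) a c" if "v \<in> V" for v
    using sc[OF that] ex_coset_coordinates by blast
  then obtain a' c' where coord': "\<And>v. v \<in> V \<Longrightarrow> coset_coordinates (G' v) (H v) (n v) (a' v) (c' v)"
    by metis
  define p where "p = (\<lambda>v\<in>V. 0 :: nat)"
  have p: "p \<in> point_space V n"
    using coset_coordinates.n_pos[OF coord] by (auto simp: p_def)
  interpret fw: diagram_cocycle "complete_subgraphs V E" "(\<subseteq>)"
    "\<lambda>S. product_group S G" "product_incl G" "\<lambda>S. product_group S G'" "product_incl G'"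
    "point_space V n" "coordinate_act V n a" "coordinate_act V n a'"
    "coordinate_transfer (\<lambda>v. coset_transfer (G' v) (a' v) (c' v) (a v) (c v))"
    by (rule diagram_cocycle_graph_product[OF coord coord'])
  let ?K = "fw.src.colim_stabilizer p" and ?K' = "fw.tgt.colim_stabilizer p"
  have "fw.src.C\<lparr>carrier := ?K\<rparr> \<cong> fw.tgt.C\<lparr>carrier := ?K'\<rparr>"
    by (rule colim_stabilizers_isomorphic[OF diagram_cocycle_graph_product[OF coord coord']
          diagram_cocycle_graph_product[OF coord' coord] _ _ p])
      (assumption | rule coordinate_transfer_inverse[OF coord coord']
        coordinate_transfer_inverse[OF coord' coord])+
  then have iso: "(graph_product V E G)\<lparr>carrier := ?K\<rparr> \<cong> (graph_product V E G')\<lparr>carrier := ?K'\<rparr>"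
    by (simp add: graph_product_def)
  let ?L = "(graph_product V E G)\<lparr>carrier := ?K\<rparr>"
  have "group ?L"
    unfolding graph_product_def
    by (intro subgroup.subgroup_is_group fw.src.subgroup_colim_stabilizer fw.src.group_colim_group p)
  moreover have "iso_to_subgroup_of_index ?L (graph_product V E G) (\<Prod>v\<in>V. n v)"
    by (rule index_graph_product_stabilizer[OF coord assms(1) p HOL.refl iso_refl])
  moreover have "iso_to_subgroup_of_index ?L (graph_product V E G') (\<Prod>v\<in>V. n v)"
    by (rule index_graph_product_stabilizer[OF coord' assms(1) p HOL.refl iso])
  ultimately have "strongly_commensurable_via ?L (\<Prod>v\<in>V. n v) (graph_product V E G) (graph_product V E G')"
    using sc by (simp add: strongly_commensurable_via_def group_graph_product)
  then show ?thesis by blast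
qed

end
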